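(* The following hold: (1) $\displaystyle \int_0^1\frac{\sin^{-1}u}{\sqrt{1-u^2}}\,du=\frac34\zeta(2)=\frac{\pi^2}{8}$; (2) $\displaystyle \frac2\pi\int_0^1\frac{\frac12(\sin^{-1}u)^2}{\sqrt{1-u^2}}\,du=\frac14\zeta(2)=\frac{\pi^2}{24}$; (3) $\displaystyle \int_0^1\left(\sin^{-1}u+\frac1\pi(\sin^{-1}u)^2\right)\frac{du}{\sqrt{1-u^2}}=\zeta(2)=\frac{\pi^2}{6}$; (4) $\displaystyle \int_0^1\frac{\sinh^{-1}u}{\sqrt{1-u^2}}\,du=G$; (5) $\displaystyle \int_0^1\frac{\frac12(\sinh^{-1}u)^2}{\sqrt{1-u^2}}\,du=\frac{\pi}{16}\zeta(2)=\frac{\pi^3}{96}$.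
   Context: $\zeta$ is the Riemann zeta function, and $G=\sum_{n=0}^\infty\frac{(-1)^n}{(2n+1)^2}$ is the Catalan constant. $\sin^{-1}$ is the real inverse sine with values in $[-\pi/2,\pi/2]$, and $\sinh^{-1}x=\log(x+\sqrt{x^2+1})$. *)

theory Defs
  imports "HOL-Analysis.Analysis"
begin

(* Only the Dirichlet series on the half-line s > 1 is covered, not the
   analytic continuation; the value used is zeta(2). The shift n + 1 makes
   the sum start at 1. *)
definition zeta :: "real \<Rightarrow> real" where
  "zeta s = (\<Sum>n. 1 / real (n + 1) powr s)"

definition catalan_const :: real where
  "catalan_const = (\<Sum>n. (-1) ^ n / (2 * real n + 1)\<^sup>2)"

(* suminf is unspecified on divergent series, so convergence is recorded. *)
lemma summable_zeta:
  assumes "s > 1"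
  shows "summable (\<lambda>n. 1 / real (n + 1) powr s)"
proof -
  have "summable (\<lambda>n. real n powr - s)"
    using assms by (simp add: summable_real_powr_iff)
  then have "summable (\<lambda>n. real (Suc n) powr - s)"
    by (subst summable_Suc_iff)
  then show ?thesis
    by (simp add: powr_minus divide_inverse)
qed

lemma summable_catalan:
  "summable (\<lambda>n. (-1) ^ n / (2 * real n + 1)\<^sup>2)"
proof (rule summable_comparison_test')
  show "summable (\<lambda>n. inverse (real (Suc n) ^ 2))"
    using inverse_power_summable[of 2, where 'a = real] by (subst summable_Suc_iff) simp
  show "norm ((-1) ^ n / (2 * real n + 1)\<^sup>2) \<le> inverse (real (Suc n) ^ 2)" if "n \<ge> 0" for n
  proof -
    have "(real (Suc n))\<^sup>2 \<le> (2 * real n + 1)\<^sup>2"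
      by (intro power_mono) auto
    then have "inverse ((2 * real n + 1)\<^sup>2) \<le> inverse ((real (Suc n))\<^sup>2)"
      by (intro le_imp_inverse_le) auto
    then show ?thesis
      by (simp add: abs_mult power_abs divide_inverse)
  qed
qed

end

theory Submission
  imports Defs
begin

text \<open>
  The substitution \<open>u = sin t\<close> removes the singular weight: the integral of
  \<open>h u / sqrt (1 - u\<^sup>2)\<close> over the unit interval is the integral of \<open>h (sin t)\<close>
  over a quarter period. For polynomials in \<open>arcsin u\<close> what remains is the integral of a
  polynomial in \<open>t\<close>, and Euler's value of the Basel sum gives the first three evaluations.

  For \<open>arsinh\<close> the point is that all combinations
  \<open>h x = p * arsinh x + s * (arsinh x)\<^sup>2 / 2\<close> solve
  \<open>(1 + x\<^sup>2) * h'' x + x * h' x = s\<close>, which says that the Taylor coefficients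
  \<open>c n\<close> of \<open>h\<close> satisfy
  \<open>(n + 2) * (n + 1) * c (n + 2) = - n\<^sup>2 * c n\<close> for \<open>n \<ge> 1\<close>.
  The moments \<open>W n\<close> of the sine over a quarter period obey Wallis' recurrence
  \<open>(n + 2) * W (n + 2) = (n + 1) * W n\<close>. Multiplying the two, the product
  \<open>n\<^sup>2 * c n * W n\<close> merely changes sign when \<open>n\<close> grows by two. Integrating the
  Taylor series term by term therefore leaves \<open>p\<close> times the alternating sum of the inverse
  odd squares, which is Catalan's constant, plus \<open>s * pi / 8\<close> times the alternating sum of
  all inverse squares, which is \<open>pi\<^sup>2 / 12\<close>.

  Two analytic points remain. That the power series with coefficients \<open>c n\<close> represents
  \<open>h\<close> on the open unit interval follows from the differential equation
  (\<open>arsinh_combination_sums\<close>). Since the argument \<open>sin t\<close> reaches the boundary of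
  the disc of convergence, the termwise integration is carried out for \<open>h (r * sin t)\<close> with
  \<open>r < 1\<close> (\<open>integral_arsinh_combination_scaled_sin\<close>), and both sides are then
  continued to \<open>r = 1\<close> (\<open>integral_arsinh_combination_sin\<close>): the integrated series
  converges uniformly up to \<open>r = 1\<close> because its coefficients are \<open>O(1 / n\<^sup>2)\<close>.
\<close>

section \<open>The substitution \<open>u = sin t\<close>\<close>

text \<open>
  The integrand on the left may be unbounded near \<open>1\<close>, but it has a tame primitive: a primitive
  of \<open>h (sin t)\<close> composed with \<open>arcsin\<close> is continuous on the closed interval and
  differentiable inside, which is enough for the fundamental theorem of calculus.
\<close>
lemma has_integral_over_sqrt_one_minus_square:
  fixes h :: "real \<Rightarrow> real"
  assumes "continuous_on {0..1} h"
  shows "((\<lambda>u. h u / sqrt (1 - u\<^sup>2)) has_integral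
           integral {0..pi / 2} (\<lambda>t. h (sin t))) {0..1}"
proof -
  define H where "H = (\<lambda>x. integral {0..x} (\<lambda>t. h (sin t)))"
  have sin01: "sin t \<in> {0..1}" if "t \<in> {0..pi / 2}" for t
    using that by (auto intro: sin_ge_zero)
  have cont: "continuous_on {0..pi / 2} (\<lambda>t. h (sin t))"
    by (rule continuous_on_compose2[OF assms]) (use sin01 in \<open>auto intro!: continuous_intros\<close>)
  have contH: "continuous_on {0..pi / 2} H"
    unfolding H_def by (intro indefinite_integral_continuous_1 integrable_continuous_real cont)
  have "((\<lambda>u. h u / sqrt (1 - u\<^sup>2)) has_integral H (arcsin 1) - H (arcsin 0)) {0..1}"
  proof (rule fundamental_theorem_of_calculus_interior)
    have "arcsin u \<in> {0..pi / 2}" if "u \<in> {0..1}" for u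
      using that arcsin_le_arcsin[of 0 u] arcsin_ubound[of u] by auto
    then show "continuous_on {0..1} (\<lambda>u. H (arcsin u))"
      by (intro continuous_on_compose2[OF contH] continuous_on_subset[OF continuous_on_arcsin']) auto
    fix u :: real assume u: "u \<in> {0<..<1}"
    then have t: "arcsin u \<in> {0<..<pi / 2}"
      using arcsin_less_arcsin[of 0 u] arcsin_less_arcsin[of u 1] by auto
    then have "arcsin u \<in> interior {0..pi / 2}" "arcsin u \<in> {0..pi / 2}"
      by (auto simp: interior_atLeastAtMost_real)
    then have "(H has_real_derivative h (sin (arcsin u))) (at (arcsin u))"
      using integral_has_real_derivative[OF cont, of "arcsin u"] at_within_interior
      unfolding H_def by metis
    then have "((\<lambda>u. H (arcsin u)) has_real_derivative h u * inverse (sqrt (1 - u\<^sup>2))) (at u)"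
      using DERIV_chain2[OF _ DERIV_arcsin[of u]] u by (simp add: sin_arcsin)
    then show "((\<lambda>u. H (arcsin u)) has_vector_derivative h u / sqrt (1 - u\<^sup>2)) (at u)"
      by (simp add: has_real_derivative_iff_has_vector_derivative divide_inverse)
  qed auto
  then show ?thesis by (simp add: H_def)
qed

lemma has_integral_arcsin_polynomial:
  fixes a b :: real
  shows "((\<lambda>u. (a * arcsin u + b * (arcsin u)\<^sup>2) / sqrt (1 - u\<^sup>2)) has_integral
      a * (pi\<^sup>2 / 8) + b * (pi ^ 3 / 24)) {0..1}"
proof -
  have cont: "continuous_on {0..1} (\<lambda>u. a * arcsin u + b * (arcsin u)\<^sup>2)"
    by (intro continuous_intros) auto
  have "((\<lambda>t. a * t + b * t\<^sup>2) has_integral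
      (a * ((pi / 2)\<^sup>2 / 2) + b * ((pi / 2) ^ 3 / 3)) - (a * (0\<^sup>2 / 2) + b * (0 ^ 3 / 3))) {0..pi / 2}"
    by (rule fundamental_theorem_of_calculus)
      (auto intro!: derivative_eq_intros simp flip: has_real_derivative_iff_has_vector_derivative)
  moreover have "integral {0..pi / 2} (\<lambda>t. a * arcsin (sin t) + b * (arcsin (sin t))\<^sup>2)
      = integral {0..pi / 2} (\<lambda>t. a * t + b * t\<^sup>2)"
    by (intro integral_cong) (auto simp: arcsin_sin)
  ultimately have "integral {0..pi / 2} (\<lambda>t. a * arcsin (sin t) + b * (arcsin (sin t))\<^sup>2)
      = a * (pi\<^sup>2 / 8) + b * (pi ^ 3 / 24)"
    by (simp add: integral_unique power_divide)
  then show ?thesis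
    using has_integral_over_sqrt_one_minus_square[OF cont] by (simp only:)
qed

section \<open>Moments of the sine\<close>

definition wallis :: "nat \<Rightarrow> real" where
  "wallis n = integral {0..pi / 2} (\<lambda>t. sin t ^ n)"

lemma wallis_0: "wallis 0 = pi / 2"
  by (simp add: wallis_def)

lemma wallis_1: "wallis 1 = 1"
proof -
  have "(sin has_integral - cos (pi / 2) - - cos 0) {0..pi / 2}"
    by (rule fundamental_theorem_of_calculus)
      (auto intro!: derivative_eq_intros simp flip: has_real_derivative_iff_has_vector_derivative)
  then show ?thesis by (simp add: wallis_def integral_unique)
qed

lemma wallis_integral:
  "((\<lambda>t. sin t ^ n) has_integral wallis n) {0..pi / 2}"
  unfolding wallis_def
  by (intro integrable_integral integrable_continuous_real continuous_intros)

text \<open>Integrate the derivative of \<open>- cos t * sin t ^ (n + 1)\<close>, which vanishes at both ends.\<close>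
lemma wallis_rec: "(real n + 2) * wallis (n + 2) = (real n + 1) * wallis n"
proof -
  define f where "f = (\<lambda>t::real. (real n + 2) * sin t ^ (n + 2) - (real n + 1) * sin t ^ n)"
  have "(f has_integral - cos (pi / 2) * sin (pi / 2) ^ (n + 1) - - cos 0 * sin 0 ^ (n + 1)) {0..pi / 2}"
  proof (rule fundamental_theorem_of_calculus)
    fix t :: real
    have "((\<lambda>t. - cos t * sin t ^ (n + 1)) has_real_derivative
            sin t * sin t ^ (n + 1) - cos t * ((real n + 1) * sin t ^ n * cos t)) (at t within {0..pi / 2})"
    proof -
      have "((\<lambda>t. sin t ^ Suc n) has_real_derivative (1 + real n) * (cos t * sin t ^ n)) (at t within {0..pi / 2})"
        by (rule DERIV_power_Suc[OF has_field_derivative_at_within[OF DERIV_sin]])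
      moreover have "((\<lambda>t. - cos t) has_real_derivative sin t) (at t within {0..pi / 2})"
        by (auto intro!: derivative_eq_intros)
      ultimately have "((\<lambda>t. - cos t * sin t ^ Suc n) has_real_derivative
          sin t * sin t ^ Suc n + (1 + real n) * (cos t * sin t ^ n) * - cos t) (at t within {0..pi / 2})"
        by (intro DERIV_mult)
      then show ?thesis by (simp add: algebra_simps)
    qed
    moreover have cos_sq: "cos t * cos t = 1 - (sin t)\<^sup>2"
      using sin_cos_squared_add[of t] unfolding power2_eq_square by linarith
    have "cos t * ((real n + 1) * sin t ^ n * cos t)
        = (real n + 1) * sin t ^ n * (1 - (sin t)\<^sup>2)"
      by (subst cos_sq[symmetric]) (simp only: mult_ac)
    then have "sin t * sin t ^ (n + 1) - cos t * ((real n + 1) * sin t ^ n * cos t) = f t"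
      by (simp add: f_def algebra_simps power2_eq_square)
    ultimately show "((\<lambda>t. - cos t * sin t ^ (n + 1)) has_vector_derivative f t) (at t within {0..pi / 2})"
      by (simp only: has_real_derivative_iff_has_vector_derivative)
  qed simp
  moreover have "(f has_integral (real n + 2) * wallis (n + 2) - (real n + 1) * wallis n) {0..pi / 2}"
    unfolding f_def by (intro has_integral_diff has_integral_mult_right wallis_integral)
  ultimately have "(real n + 2) * wallis (n + 2) - (real n + 1) * wallis n
      = - cos (pi / 2) * sin (pi / 2) ^ (n + 1) - - cos 0 * sin 0 ^ (n + 1)"
    by (rule has_integral_unique[rotated])
  then show ?thesis by simp
qed

text \<open>
  A polynomial lower bound is what keeps the Taylor coefficients below, which have
  \<open>wallis n\<close> in the denominator, from growing. The bound propagates because Wallis'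
  recurrence multiplies \<open>(n + 1) * wallis n\<close> by \<open>(n + 3) / (n + 2) \<ge> 1\<close> when \<open>n\<close> grows
  by two.
\<close>
lemma wallis_lower_bound: "1 \<le> (real n + 1) * wallis n"
proof (induction n rule: nat_induct2)
  case 0
  then show ?case using pi_gt3 by (simp add: wallis_0)
next
  case 1
  then show ?case using wallis_1 by simp
next
  case (step n)
  have "wallis (n + 2) = (real n + 1) * wallis n / (real n + 2)"
    using wallis_rec[of n] by (simp add: field_simps)
  then have "(real (n + 2) + 1) * wallis (n + 2)
      = (real n + 3) / (real n + 2) * ((real n + 1) * wallis n)"
    by (simp add: field_simps)
  moreover have "1 * 1 \<le> (real n + 3) / (real n + 2) * ((real n + 1) * wallis n)"
    using step by (intro mult_mono) auto
  ultimately show ?case by simp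
qed

lemma wallis_pos: "0 < wallis n"
  using wallis_lower_bound[of n]
  by (smt (verit) mult_nonneg_nonpos of_nat_0_le_iff)

section \<open>Sums of inverse squares\<close>

lemma zeta_2: "zeta 2 = pi\<^sup>2 / 6"
proof -
  have "(\<lambda>n. 1 / real (n + 1) powr 2) = (\<lambda>n. 1 / real (n + 1) ^ 2)"
    by (intro ext) (simp add: powr_numeral)
  then show ?thesis
    unfolding zeta_def using inverse_squares_sums by (simp add: sums_iff)
qed

text \<open>
  Subtract twice the even-denominator terms from the Basel sum; together those terms are a quarter
  of it, so half of it remains.
\<close>
lemma alternating_inverse_squares_sums:
  "(\<lambda>n. (-1) ^ n / (real n + 1)\<^sup>2) sums (pi\<^sup>2 / 12)"
proof -
  have sq: "(\<lambda>n. 1 / (real n + 1)\<^sup>2) sums (pi\<^sup>2 / 6)"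
    using inverse_squares_sums by (simp add: add.commute)
  have "(\<lambda>n. 1 / 2 * (1 / (real n + 1)\<^sup>2)) sums (1 / 2 * (pi\<^sup>2 / 6))"
    by (rule sums_mult[OF sq])
  then have "(\<lambda>n. if even n then 0 else 1 / 2 * (1 / (real ((n - 1) div 2) + 1)\<^sup>2)) sums (1 / 2 * (pi\<^sup>2 / 6))"
    by (rule sums_if')
  from sums_diff[OF sq this]
  have "(\<lambda>n. 1 / (real n + 1)\<^sup>2
     - (if even n then 0 else 1 / 2 * (1 / (real ((n - 1) div 2) + 1)\<^sup>2))) sums (pi\<^sup>2 / 12)"
    by simp
  moreover have "1 / (real n + 1)\<^sup>2
     - (if even n then 0 else 1 / 2 * (1 / (real ((n - 1) div 2) + 1)\<^sup>2)) = (-1) ^ n / (real n + 1)\<^sup>2" for n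
  proof (cases "even n")
    case False
    then obtain k where k: "n = 2 * k + 1" by (auto elim: oddE)
    have half: "(n - 1) div 2 = k" by (simp add: k)
    have "real n + 1 = 2 * (real k + 1)" by (simp add: k)
    then have square: "(real n + 1)\<^sup>2 = 4 * (real k + 1)\<^sup>2"
      by (simp only: power_mult_distrib) simp
    have "1 / (4 * y) - 1 / 2 * (1 / y) = - 1 / (4 * y)" for y :: real
      by (cases "y = 0") (simp_all add: field_simps)
    moreover have "(-1) ^ n = (-1 :: real)"
      using False by simp
    ultimately show ?thesis
      using False by (simp only: half square if_False)
  qed simp
  ultimately show ?thesis by simp
qed

section \<open>The Taylor series of \<open>p * arsinh x + s * (arsinh x)\<^sup>2 / 2\<close>\<close>

context
  fixes p s :: real
begin

text \<open>
  For \<open>n \<ge> 1\<close> these are the numbers \<open>n\<^sup>2 * c n * wallis n\<close>, where \<open>c n\<close> are the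
  Taylor coefficients of \<open>h x = p * arsinh x + s * (arsinh x)\<^sup>2 / 2\<close>. They change sign when
  \<open>n\<close> grows by two, so the values at \<open>1\<close> and \<open>2\<close> determine them: \<open>p\<close>, since \<open>h' 0 = p\<close> and
  \<open>wallis 1 = 1\<close>, and \<open>4 * (s / 2) * (pi / 4) = s * (pi / 2)\<close>, since \<open>h'' 0 = s\<close> and
  \<open>wallis 2 = pi / 4\<close>.
\<close>
definition quarter_wave :: "nat \<Rightarrow> real" where
  "quarter_wave n = p * sin (real n * (pi / 2)) - s * (pi / 2) * cos (real n * (pi / 2))"

text \<open>
  Dividing by the Wallis moments makes the termwise integrals immediate; the recurrence for the
  coefficients is then a consequence of Wallis'. At \<open>n = 0\<close> the quotient is
  \<open>0\<close> by division by zero, which is the wanted value \<open>h 0 = 0\<close>.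
\<close>
definition taylor_coeff :: "nat \<Rightarrow> real" where
  "taylor_coeff n = quarter_wave n / ((real n)\<^sup>2 * wallis n)"

lemma quarter_wave_add_2: "quarter_wave (n + 2) = - quarter_wave n"
proof -
  have "real (n + 2) * (pi / 2) = real n * (pi / 2) + pi" by (simp add: field_simps)
  then show ?thesis
    by (simp only: quarter_wave_def sin_periodic_pi cos_periodic_pi)
qed

lemma quarter_wave_bound: "\<bar>quarter_wave n\<bar> \<le> \<bar>p\<bar> + \<bar>s\<bar> * (pi / 2)"
proof -
  have "\<bar>quarter_wave n\<bar> \<le> \<bar>p * sin (real n * (pi / 2))\<bar> + \<bar>s * (pi / 2) * cos (real n * (pi / 2))\<bar>"
    unfolding quarter_wave_def by linarith
  also have "\<dots> \<le> \<bar>p\<bar> * 1 + \<bar>s\<bar> * (pi / 2) * 1"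
    unfolding abs_mult by (intro add_mono mult_mono) auto
  finally show ?thesis by simp
qed

lemma taylor_coeff_0: "taylor_coeff 0 = 0"
  by (simp add: taylor_coeff_def)

lemma taylor_coeff_1: "taylor_coeff 1 = p"
  using wallis_1 by (simp add: taylor_coeff_def quarter_wave_def)

lemma taylor_coeff_bound: "\<bar>taylor_coeff n\<bar> \<le> 2 * (\<bar>p\<bar> + \<bar>s\<bar> * (pi / 2))"
proof (cases "n = 0")
  case False
  have "real n + 1 \<le> 2 * (real n)\<^sup>2"
    using False by (cases n) (auto simp: power2_eq_square algebra_simps)
  then have "(real n + 1) * wallis n \<le> 2 * (real n)\<^sup>2 * wallis n"
    by (intro mult_right_mono) (auto intro: less_imp_le wallis_pos)
  then have "1 \<le> 2 * (real n)\<^sup>2 * wallis n"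
    by (rule order_trans[OF wallis_lower_bound])
  then have "1 / ((real n)\<^sup>2 * wallis n) \<le> 2"
    using False wallis_pos[of n] by (simp add: divide_le_eq mult.assoc)
  moreover have "0 \<le> 1 / ((real n)\<^sup>2 * wallis n)"
    using wallis_pos[of n] by simp
  ultimately have "\<bar>quarter_wave n\<bar> * (1 / ((real n)\<^sup>2 * wallis n)) \<le> (\<bar>p\<bar> + \<bar>s\<bar> * (pi / 2)) * 2"
    by (intro mult_mono quarter_wave_bound) auto
  then show ?thesis
    using wallis_pos[of n] by (simp add: taylor_coeff_def abs_mult mult.commute)
qed (simp add: taylor_coeff_0)

lemma taylor_coeff_summable:
  assumes "\<bar>x\<bar> < 1"
  shows "summable (\<lambda>n. taylor_coeff n * x ^ n)"
proof (rule summable_comparison_test')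
  show "summable (\<lambda>n. 2 * (\<bar>p\<bar> + \<bar>s\<bar> * (pi / 2)) * \<bar>x\<bar> ^ n)"
    using assms by (intro summable_mult summable_geometric) auto
  show "norm (taylor_coeff n * x ^ n) \<le> 2 * (\<bar>p\<bar> + \<bar>s\<bar> * (pi / 2)) * \<bar>x\<bar> ^ n" for n
    unfolding real_norm_def abs_mult power_abs by (intro mult_right_mono taylor_coeff_bound) simp
qed

text \<open>
  For \<open>n \<ge> 1\<close> the right-hand side is \<open>- n\<^sup>2\<close> times the \<open>n\<close>-th coefficient, so this is
  the recurrence that the differential equation asks for. At \<open>n = 0\<close> it is the inhomogeneity
  \<open>s\<close>.
\<close>
lemma diffs_diffs_taylor_coeff: "diffs (diffs taylor_coeff) n = - quarter_wave n / wallis n"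
proof -
  have "real (n + 2) = real n + 2" by simp
  then have "(real (n + 2))\<^sup>2 * wallis (n + 2) = (real n + 2) * ((real n + 1) * wallis n)"
    by (simp only: power2_eq_square mult.assoc wallis_rec)
  then have "taylor_coeff (n + 2) = - quarter_wave n / ((real n + 2) * ((real n + 1) * wallis n))"
    by (simp only: taylor_coeff_def quarter_wave_add_2)
  moreover have "a * (b * (- q / (b * (a * w)))) = - q / w" if "a \<noteq> 0" "b \<noteq> 0" for a b q w :: real
    using that by simp
  moreover have "real n + 2 \<noteq> 0" "real n + 1 \<noteq> 0" by (smt (verit) of_nat_0_le_iff)+
  moreover have "diffs (diffs taylor_coeff) n = (real n + 1) * ((real n + 2) * taylor_coeff (n + 2))"
    by (simp add: diffs_def add.commute)
  ultimately show ?thesis by simp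
qed

text \<open>
  On the series, \<open>x\<^sup>2 * h'' + x * h'\<close> multiplies the \<open>n\<close>-th coefficient by
  \<open>n\<^sup>2\<close>, which gives exactly the negative of the \<open>n\<close>-th coefficient of
  \<open>h''\<close> except at \<open>n = 0\<close>, where the constant \<open>s\<close> is left over.
\<close>
lemma taylor_series_ode:
  assumes x: "\<bar>x\<bar> < 1"
  shows "(1 + x\<^sup>2) * (\<Sum>n. diffs (diffs taylor_coeff) n * x ^ n) + x * (\<Sum>n. diffs taylor_coeff n * x ^ n) = s"
proof -
  let ?c = taylor_coeff and ?A1 = "\<Sum>n. diffs taylor_coeff n * x ^ n" and ?A2 = "\<Sum>n. diffs (diffs taylor_coeff) n * x ^ n"
  have sum1: "summable (\<lambda>n. diffs ?c n * x ^ n)" if "norm x < 1" for x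
    by (rule termdiff_converges[OF that]) (simp add: taylor_coeff_summable)
  have s1: "(\<lambda>n. diffs ?c n * x ^ n) sums ?A1"
    using sum1 x by (intro summable_sums) auto
  have s2: "(\<lambda>n. diffs (diffs ?c) n * x ^ n) sums ?A2"
    by (intro summable_sums termdiff_converges[of _ 1] sum1) (use x in auto)
  have "(\<lambda>n. x * (diffs ?c n * x ^ n)) sums (x * ?A1)"
    by (rule sums_mult[OF s1])
  then have "(\<lambda>n. real (Suc n) * ?c (Suc n) * x ^ Suc n) sums (x * ?A1)"
    by (simp add: diffs_def mult_ac)
  then have t1: "(\<lambda>n. real n * ?c n * x ^ n) sums (x * ?A1)"
    by (subst (asm) sums_Suc_iff) simp
  have "(\<lambda>n. x\<^sup>2 * (diffs (diffs ?c) n * x ^ n)) sums (x\<^sup>2 * ?A2)"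
    by (rule sums_mult[OF s2])
  then have "(\<lambda>n. real (n + 2) * (real (n + 2) - 1) * ?c (n + 2) * x ^ (n + 2)) sums (x\<^sup>2 * ?A2)"
    by (simp add: diffs_def mult_ac power2_eq_square)
  then have t2: "(\<lambda>n. real n * (real n - 1) * ?c n * x ^ n) sums (x\<^sup>2 * ?A2)"
    by (subst (asm) sums_iff_shift) (simp add: numeral_2_eq_2)
  have "(\<lambda>n. diffs (diffs ?c) n * x ^ n + (real n * (real n - 1) * ?c n * x ^ n + real n * ?c n * x ^ n))
      sums (?A2 + (x\<^sup>2 * ?A2 + x * ?A1))"
    by (intro sums_add s2 t2 t1)
  moreover have "diffs (diffs ?c) n * x ^ n + (real n * (real n - 1) * ?c n * x ^ n + real n * ?c n * x ^ n)
      = (if n = 0 then s else 0)" for n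
  proof (cases "n = 0")
    case True
    then show ?thesis by (simp add: diffs_diffs_taylor_coeff quarter_wave_def wallis_0)
  next
    case False
    have "real n * (real n - 1) * ?c n + real n * ?c n = (real n)\<^sup>2 * ?c n"
      by (simp add: algebra_simps power2_eq_square)
    also have "\<dots> = quarter_wave n / wallis n"
      using False by (simp add: taylor_coeff_def)
    finally show ?thesis
      using False by (simp add: diffs_diffs_taylor_coeff flip: distrib_right)
  qed
  ultimately have "(\<lambda>n. if n = 0 then s else 0) sums (?A2 + (x\<^sup>2 * ?A2 + x * ?A1))"
    by simp
  moreover have "(\<lambda>n. if n = 0 then s else 0) sums s"
    using sums_single[of 0 "\<lambda>_. s"] by simp
  ultimately have "?A2 + (x\<^sup>2 * ?A2 + x * ?A1) = s"
    by (rule sums_unique2)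
  then show ?thesis by (simp add: algebra_simps)
qed

text \<open>
  The differential equation for the sum \<open>A\<close> of the series integrates in two steps. After
  division by \<open>sqrt (1 + x\<^sup>2)\<close> it says that \<open>sqrt (1 + x\<^sup>2) * A' x\<close> has the
  derivative \<open>s / sqrt (1 + x\<^sup>2)\<close> of \<open>s * arsinh x\<close>. Hence
  \<open>A' x = (p + s * arsinh x) / sqrt (1 + x\<^sup>2)\<close>, which is the derivative of the claimed
  sum.
\<close>
lemma arsinh_combination_sums:
  assumes x: "\<bar>x\<bar> < 1"
  shows "(\<lambda>n. taylor_coeff n * x ^ n) sums (p * arsinh x + s * (1 / 2 * (arsinh x)\<^sup>2))"
proof -
  define A where "A = (\<lambda>x. \<Sum>n. taylor_coeff n * x ^ n)"
  define A1 where "A1 = (\<lambda>x. \<Sum>n. diffs taylor_coeff n * x ^ n)"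
  define A2 where "A2 = (\<lambda>x. \<Sum>n. diffs (diffs taylor_coeff) n * x ^ n)"
  let ?I = "{-1<..<1::real}"
  have dA: "(A has_real_derivative A1 x) (at x)" if "x \<in> ?I" for x
    unfolding A_def A1_def
    by (rule termdiffs_strong'[of 1]) (use that taylor_coeff_summable in auto)
  have dA1: "(A1 has_real_derivative A2 x) (at x)" if "x \<in> ?I" for x
    unfolding A1_def A2_def
    by (rule termdiffs_strong'[of 1], rule termdiff_converges[of _ 1])
      (use that taylor_coeff_summable in auto)
  have pos: "0 < x\<^sup>2 + 1" for x :: real by (simp add: add_nonneg_pos)
  have A10: "A1 0 = p" and A0: "A 0 = 0"
    using taylor_coeff_1 taylor_coeff_0 by (simp_all add: A_def A1_def powser_zero diffs_def)
  have "\<exists>c. \<forall>x\<in>?I. sqrt (x\<^sup>2 + 1) * A1 x - s * arsinh x = c"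
  proof (rule has_field_derivative_zero_constant)
    fix x assume x: "x \<in> ?I"
    have "((\<lambda>x. sqrt (x\<^sup>2 + 1) * A1 x - s * arsinh x) has_real_derivative
        inverse (sqrt (x\<^sup>2 + 1)) * x * A1 x + sqrt (x\<^sup>2 + 1) * A2 x - s * (1 / sqrt (x\<^sup>2 + 1))) (at x within ?I)"
      using pos[of x]
      by (auto intro!: derivative_eq_intros has_field_derivative_at_within[OF dA1[OF x]])
    moreover have "inverse (sqrt (x\<^sup>2 + 1)) * x * A1 x + sqrt (x\<^sup>2 + 1) * A2 x - s * (1 / sqrt (x\<^sup>2 + 1))
        = (x * A1 x + (1 + x\<^sup>2) * A2 x - s) / sqrt (x\<^sup>2 + 1)"
    proof -
      have "sqrt (x\<^sup>2 + 1) = (1 + x\<^sup>2) / sqrt (x\<^sup>2 + 1)"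
        using pos[of x] by (simp add: real_div_sqrt add.commute)
      then have "sqrt (x\<^sup>2 + 1) * A2 x = (1 + x\<^sup>2) * A2 x / sqrt (x\<^sup>2 + 1)"
        by (metis times_divide_eq_left)
      moreover have "inverse (sqrt (x\<^sup>2 + 1)) * x * A1 x = x * A1 x / sqrt (x\<^sup>2 + 1)"
        by (simp only: divide_inverse mult_ac)
      ultimately show ?thesis by (simp only: diff_divide_distrib add_divide_distrib) simp
    qed
    moreover have "x * A1 x + (1 + x\<^sup>2) * A2 x - s = 0"
      using taylor_series_ode[of x] x unfolding A1_def A2_def by (simp add: abs_less_iff add.commute)
    ultimately show "((\<lambda>x. sqrt (x\<^sup>2 + 1) * A1 x - s * arsinh x) has_real_derivative 0) (at x within ?I)"
      by simp
  qed simp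
  then obtain c where c: "\<And>x. x \<in> ?I \<Longrightarrow> sqrt (x\<^sup>2 + 1) * A1 x - s * arsinh x = c" by blast
  have "c = p" using c[of 0] A10 by simp
  then have A1_eq: "A1 x = (p + s * arsinh x) / sqrt (x\<^sup>2 + 1)" if "x \<in> ?I" for x
    using c[OF that] pos[of x] by (simp add: field_simps)
  have "\<exists>c. \<forall>x\<in>?I. A x - (p * arsinh x + s * (1 / 2 * (arsinh x)\<^sup>2)) = c"
  proof (rule has_field_derivative_zero_constant)
    fix x assume x: "x \<in> ?I"
    show "((\<lambda>x. A x - (p * arsinh x + s * (1 / 2 * (arsinh x)\<^sup>2))) has_real_derivative 0) (at x within ?I)"
      by (auto intro!: derivative_eq_intros has_field_derivative_at_within[OF dA[OF x]]
          simp: A1_eq[OF x] add_divide_distrib)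
  qed simp
  then obtain d where d: "\<And>x. x \<in> ?I \<Longrightarrow> A x - (p * arsinh x + s * (1 / 2 * (arsinh x)\<^sup>2)) = d"
    by blast
  have "d = 0" using d[of 0] A0 by simp
  then have "A x = p * arsinh x + s * (1 / 2 * (arsinh x)\<^sup>2)"
    using d[of x] x by (simp add: abs_less_iff)
  then show ?thesis
    using summable_sums[OF taylor_coeff_summable[OF x]] by (simp add: A_def)
qed

section \<open>Termwise integration\<close>

text \<open>
  The odd terms carry \<open>p\<close> and sum to Catalan's constant. The even terms carry
  \<open>s\<close>; pulling the factor \<open>4\<close> out of the even squares leaves
  \<open>s * pi / 8\<close> times the alternating sum of all inverse squares.
\<close>
lemma quarter_wave_over_squares_sums: "(\<lambda>n. quarter_wave n / (real n)\<^sup>2) sums (p * catalan_const + s * (pi ^ 3 / 96))"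
proof -
  have w: "quarter_wave (2 * m + 1) = p * (-1) ^ m \<and> quarter_wave (2 * m + 2) = s * (pi / 2) * (-1) ^ m" for m
  proof (induction m)
    case 0
    then show ?case by (simp add: quarter_wave_def)
  next
    case (Suc m)
    then show ?case using quarter_wave_add_2[of "2 * m + 1"] quarter_wave_add_2[of "2 * m + 2"]
      by (simp add: numeral_eq_Suc)
  qed
  have "(\<lambda>m. p * ((-1) ^ m / (2 * real m + 1)\<^sup>2)) sums (p * catalan_const)"
    unfolding catalan_const_def by (intro sums_mult summable_sums summable_catalan)
  then have odd: "(\<lambda>m. quarter_wave (2 * m + 1) / (real (2 * m + 1))\<^sup>2) sums (p * catalan_const)"
    using w by (simp add: add.commute)
  have "(\<lambda>m. s * (pi / 8) * ((-1) ^ m / (real m + 1)\<^sup>2)) sums (s * (pi / 8) * (pi\<^sup>2 / 12))"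
    by (intro sums_mult alternating_inverse_squares_sums)
  moreover have "quarter_wave (2 * m + 2) / (real (2 * m + 2))\<^sup>2 = s * (pi / 8) * ((-1) ^ m / (real m + 1)\<^sup>2)" for m
  proof -
    have "real (2 * m + 2) = 2 * (real m + 1)" by simp
    then show ?thesis using w[of m] by (simp only: power_mult_distrib) simp
  qed
  ultimately have even: "(\<lambda>m. quarter_wave (2 * m + 2) / (real (2 * m + 2))\<^sup>2) sums (s * (pi ^ 3 / 96))"
    by (simp add: power2_eq_square power3_eq_cube mult_ac)
  \<comment> \<open>after the shift by one, the odd denominators sit at the even indices\<close>
  have "(\<lambda>n. quarter_wave (n + 1) / (real (n + 1))\<^sup>2) sums (s * (pi ^ 3 / 96) + p * catalan_const)"
  proof -
    have "(if even n then quarter_wave (2 * (n div 2) + 1) / (real (2 * (n div 2) + 1))\<^sup>2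
        else quarter_wave (2 * ((n - 1) div 2) + 2) / (real (2 * ((n - 1) div 2) + 2))\<^sup>2)
        = quarter_wave (n + 1) / (real (n + 1))\<^sup>2" for n
    proof (cases "even n")
      case True
      then show ?thesis by simp
    next
      case False
      then have "2 * ((n - 1) div 2) + 2 = n + 1" by presburger
      then show ?thesis using False by metis
    qed
    then show ?thesis using sums_if[OF even odd] by simp
  qed
  then show ?thesis
    by (subst (asm) sums_iff_shift) (simp add: add.commute)
qed

lemma quarter_wave_over_squares_abs_summable: "summable (\<lambda>n. \<bar>quarter_wave n / (real n)\<^sup>2\<bar>)"
proof (rule summable_comparison_test')
  show "summable (\<lambda>n. (\<bar>p\<bar> + \<bar>s\<bar> * (pi / 2)) * inverse (real n ^ 2))"
    by (intro summable_mult inverse_power_summable) simp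
  show "norm \<bar>quarter_wave n / (real n)\<^sup>2\<bar> \<le> (\<bar>p\<bar> + \<bar>s\<bar> * (pi / 2)) * inverse (real n ^ 2)" for n
    using divide_right_mono[OF quarter_wave_bound[of n] zero_le_power2[of "real n"]]
    by (simp only: real_norm_def abs_idempotent abs_divide abs_power2 divide_inverse[symmetric])
qed

text \<open>
  For \<open>r < 1\<close> the arguments \<open>r * sin t\<close> stay in a compact part of the disc of
  convergence, so the Taylor series converges uniformly in \<open>t\<close>.
\<close>
lemma integral_arsinh_combination_scaled_sin:
  assumes r: "r \<in> {0..<1}"
  shows "integral {0..pi / 2} (\<lambda>t. p * arsinh (r * sin t) + s * (1 / 2 * (arsinh (r * sin t))\<^sup>2))
    = (\<Sum>n. quarter_wave n / (real n)\<^sup>2 * r ^ n)"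
proof -
  let ?h = "\<lambda>x. p * arsinh x + s * (1 / 2 * (arsinh x)\<^sup>2)"
  let ?f = "\<lambda>N t. \<Sum>n<N. taylor_coeff n * (r * sin t) ^ n"
  have small: "\<bar>r * sin t\<bar> \<le> r" for t
    using r mult_left_mono[of "\<bar>sin t\<bar>" 1 r] by (simp add: abs_mult)
  have "uniform_limit {0..pi / 2} ?f (\<lambda>t. \<Sum>n. taylor_coeff n * (r * sin t) ^ n) sequentially"
  proof (rule Weierstrass_m_test)
    show "norm (taylor_coeff n * (r * sin t) ^ n) \<le> norm (taylor_coeff n * r ^ n)" for n t
      using power_mono[OF small[of t], of n] r
      by (auto simp: abs_mult power_abs power_mult_distrib intro!: mult_left_mono)
    \<comment> \<open>absolute convergence at \<open>r\<close> follows from convergence at the midpoint of \<open>r\<close> and \<open>1\<close>\<close>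
    show "summable (\<lambda>n. norm (taylor_coeff n * r ^ n))"
      by (rule powser_insidea[of _ "(r + 1) / 2"]) (use r taylor_coeff_summable in auto)
  qed
  moreover have "(\<Sum>n. taylor_coeff n * (r * sin t) ^ n) = ?h (r * sin t)" for t
    using arsinh_combination_sums[of "r * sin t"] small[of t] r by (auto simp: sums_iff)
  ultimately have u: "uniform_limit {0..pi / 2} ?f (\<lambda>t. ?h (r * sin t)) sequentially"
    by simp
  obtain I J where I: "\<And>N. (?f N has_integral I N) {0..pi / 2}"
    and J: "((\<lambda>t. ?h (r * sin t)) has_integral J) {0..pi / 2}" and IJ: "I \<longlonglongrightarrow> J"
    by (rule uniform_limit_integral[OF u]) (auto intro!: continuous_intros)
  have "(?f N has_integral (\<Sum>n<N. taylor_coeff n * r ^ n * wallis n)) {0..pi / 2}" for N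
    unfolding power_mult_distrib mult.assoc[symmetric]
    by (intro has_integral_sum has_integral_mult_right wallis_integral) auto
  then have "I N = (\<Sum>n<N. taylor_coeff n * r ^ n * wallis n)" for N
    using has_integral_unique I by blast
  moreover have "taylor_coeff n * r ^ n * wallis n = quarter_wave n / (real n)\<^sup>2 * r ^ n" for n
    using wallis_pos[of n] by (simp add: taylor_coeff_def)
  ultimately have "I = (\<lambda>N. \<Sum>n<N. quarter_wave n / (real n)\<^sup>2 * r ^ n)"
    by auto
  with IJ have "(\<lambda>n. quarter_wave n / (real n)\<^sup>2 * r ^ n) sums J"
    unfolding sums_def by metis
  then show ?thesis
    using integral_unique[OF J] sums_unique by (simp only:)
qed

text \<open>
  Both sides of the previous identity are continuous in \<open>r\<close> on the closed unit interval,
  so it persists at \<open>r = 1\<close>.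
\<close>
lemma integral_arsinh_combination_sin:
  "integral {0..pi / 2} (\<lambda>t. p * arsinh (sin t) + s * (1 / 2 * (arsinh (sin t))\<^sup>2))
    = p * catalan_const + s * (pi ^ 3 / 96)"
proof -
  define F where "F = (\<lambda>r. integral (cbox 0 (pi / 2))
    (\<lambda>t. p * arsinh (r * sin t) + s * (1 / 2 * (arsinh (r * sin t))\<^sup>2)))"
  define S where "S = (\<lambda>r. \<Sum>n. quarter_wave n / (real n)\<^sup>2 * r ^ n)"
  have "continuous_on {0..1} F"
    unfolding F_def
    by (intro integral_continuous_on_param, unfold case_prod_unfold)
      (intro continuous_on_compose2[OF continuous_on_arsinh[of UNIV]] continuous_intros subset_UNIV)
  moreover have "continuous_on {0..1} S"
    unfolding S_def
  proof (rule uniform_limit_theorem)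
    show "uniform_limit {0..1} (\<lambda>N r. \<Sum>n<N. quarter_wave n / (real n)\<^sup>2 * r ^ n)
        (\<lambda>r. \<Sum>n. quarter_wave n / (real n)\<^sup>2 * r ^ n) sequentially"
    proof (rule Weierstrass_m_test[OF _ quarter_wave_over_squares_abs_summable])
      fix n and r :: real assume "r \<in> {0..1}"
      then show "norm (quarter_wave n / (real n)\<^sup>2 * r ^ n) \<le> \<bar>quarter_wave n / (real n)\<^sup>2\<bar>"
        unfolding real_norm_def abs_mult by (intro mult_left_le) (auto simp: power_abs power_le_one)
    qed
  qed (intro always_eventually allI continuous_on_sum continuous_on_mult continuous_on_const
        continuous_on_power continuous_on_id, simp)
  ultimately have "continuous_on (closure {0..<1}) (\<lambda>r. F r - S r)"
    by (auto intro!: continuous_intros)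
  then have "F 1 - S 1 = 0"
    by (rule continuous_constant_on_closure)
      (simp_all add: F_def S_def integral_arsinh_combination_scaled_sin
        del: times_divide_eq_left times_divide_eq_right)
  then show ?thesis
    using quarter_wave_over_squares_sums by (simp add: F_def S_def sums_iff)
qed

end

section \<open>The five integrals\<close>

theorem corollary2p9:
  shows
    "((\<lambda>u::real. arcsin u / sqrt (1 - u\<^sup>2)) integrable_on {0..1}
       \<and> integral {0..1} (\<lambda>u::real. arcsin u / sqrt (1 - u\<^sup>2)) = 3 / 4 * zeta 2
       \<and> 3 / 4 * zeta 2 = pi\<^sup>2 / 8)
   \<and> ((\<lambda>u::real. (1 / 2 * (arcsin u)\<^sup>2) / sqrt (1 - u\<^sup>2)) integrable_on {0..1}
       \<and> 2 / pi * integral {0..1} (\<lambda>u::real. (1 / 2 * (arcsin u)\<^sup>2) / sqrt (1 - u\<^sup>2)) = 1 / 4 * zeta 2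
       \<and> 1 / 4 * zeta 2 = pi\<^sup>2 / 24)
   \<and> ((\<lambda>u::real. (arcsin u + 1 / pi * (arcsin u)\<^sup>2) * (1 / sqrt (1 - u\<^sup>2))) integrable_on {0..1}
       \<and> integral {0..1} (\<lambda>u::real. (arcsin u + 1 / pi * (arcsin u)\<^sup>2) * (1 / sqrt (1 - u\<^sup>2))) = zeta 2
       \<and> zeta 2 = pi\<^sup>2 / 6)
   \<and> ((\<lambda>u::real. arsinh u / sqrt (1 - u\<^sup>2)) integrable_on {0..1}
       \<and> integral {0..1} (\<lambda>u::real. arsinh u / sqrt (1 - u\<^sup>2)) = catalan_const)
   \<and> ((\<lambda>u::real. (1 / 2 * (arsinh u)\<^sup>2) / sqrt (1 - u\<^sup>2)) integrable_on {0..1}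
       \<and> integral {0..1} (\<lambda>u::real. (1 / 2 * (arsinh u)\<^sup>2) / sqrt (1 - u\<^sup>2)) = pi / 16 * zeta 2
       \<and> pi / 16 * zeta 2 = pi ^ 3 / 96)"
proof -
  have arsinh_poly: "((\<lambda>u. (a * arsinh u + b * (1 / 2 * (arsinh u)\<^sup>2)) / sqrt (1 - u\<^sup>2)) has_integral
      a * catalan_const + b * (pi ^ 3 / 96)) {0..1}" for a b :: real
    unfolding integral_arsinh_combination_sin [symmetric]
    by (intro has_integral_over_sqrt_one_minus_square continuous_intros)
  have i1: "((\<lambda>u::real. arcsin u / sqrt (1 - u\<^sup>2)) has_integral pi\<^sup>2 / 8) {0..1}"
    using has_integral_arcsin_polynomial[of 1 0] by simp
  have i2: "((\<lambda>u::real. (1 / 2 * (arcsin u)\<^sup>2) / sqrt (1 - u\<^sup>2)) has_integral pi ^ 3 / 48) {0..1}"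
    using has_integral_arcsin_polynomial[of 0 "1 / 2"] by simp
  have "1 * (pi\<^sup>2 / 8) + 1 / pi * (pi ^ 3 / 24) = pi\<^sup>2 / 6"
    by (simp add: power2_eq_square power3_eq_cube)
  then have i3: "((\<lambda>u::real. (arcsin u + 1 / pi * (arcsin u)\<^sup>2) * (1 / sqrt (1 - u\<^sup>2))) has_integral pi\<^sup>2 / 6) {0..1}"
    using has_integral_arcsin_polynomial[of 1 "1 / pi"] by (simp only:) simp
  have i4: "((\<lambda>u::real. arsinh u / sqrt (1 - u\<^sup>2)) has_integral catalan_const) {0..1}"
    using arsinh_poly[of 1 0] by simp
  have i5: "((\<lambda>u::real. (1 / 2 * (arsinh u)\<^sup>2) / sqrt (1 - u\<^sup>2)) has_integral pi ^ 3 / 96) {0..1}"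
    using arsinh_poly[of 0 1] by simp
  have "2 / pi * (pi ^ 3 / 48) = pi\<^sup>2 / 24" "pi / 16 * (pi\<^sup>2 / 6) = pi ^ 3 / 96"
    by (simp_all add: power2_eq_square power3_eq_cube)
  then show ?thesis
    using i1 i2 i3 i4 i5
    by (simp add: zeta_2 has_integral_integrable integral_unique
        del: times_divide_eq_left times_divide_eq_right)
qed

end
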